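(* Let $n,p,\theta$ be positive integers, and let $q_m^{(\alpha)}$ ($1\le m\le n$) and $e_m^{(\alpha)}$ ($0\le m\le n$), $\alpha=0,1,2,\dots$, be real $p\times p$ matrices generated by the generalized block qd-algorithm (see context), with associated $np\times np$ matrices $\mathscr{L}_n^{(\alpha)}$, $\mathscr{R}_n^{(\alpha)}$ and $\mathscr{J}_n^{(\alpha)}=\mathscr{L}_n^{(\alpha)}\mathscr{L}_n^{(\alpha+1)}\cdots\mathscr{L}_n^{(\alpha+\theta-1)}\mathscr{R}_n^{(\alpha)}$. Suppose that the eigenvalues $\lambda_1,\dots,\lambda_{np}$ of $\mathscr{J}_n^{(0)}$ have distinct moduli, ordered so that $|\lambda_i|>|\lambda_{i+1}|$ for $i=1,\dots,np-1$. Let $D_n=\mathrm{diag}(\lambda_1,\dots,\lambda_{np})$ and let $X_n$ be a matrix of eigenvectors associated with $D_n$, i.e. an invertible matrix with $\mathscr{J}_n^{(0)}=X_nD_nX_n^{-1}$. If the $n-1$ leading principal block minors of $X_n$ and of $X_n^{-1}$ are nonzero, then, as $\alpha\to\infty$, the sequences $q_m^{(\theta\alpha)}$ ($m=1,\dots,n$) converge and $$\lim_{\alpha\to\infty}\mathscr{J}_n^{(\theta\alpha)}=\begin{pmatrix} q_1^{\infty}&\mathbb{I}_p&&\\ &\ddots&\ddots&\\ &&q_{n-1}^{\infty}&\mathbb{I}_p\\ &&&q_n^{\infty}\end{pmatrix},\qquad q_m^{\infty}=\lim_{\alpha\to\infty}q_m^{(\theta\alpha)}.$$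
   Context: $\mathbb{I}_p$ and $\mathbb{O}_p$ are the $p\times p$ identity and zero matrices. The generalized block qd-algorithm (finite discrete non-commutative hungry Toda-II lattice): given initial real $p\times p$ matrices $q_m^{(0)}$ ($1\le m\le n$) and $e_m^{(0)},\dots,e_m^{(\theta-1)}$ ($1\le m\le n-1$), the matrices $q_m^{(\alpha)},e_m^{(\alpha)}$ are determined for all $\alpha$ by $$q_m^{(\alpha+1)}+e_{m-1}^{(\alpha+\theta)}=q_m^{(\alpha)}+e_m^{(\alpha)}\quad(1\le m\le n,\ \alpha\ge0),$$ $$e_m^{(\alpha+\theta)}q_m^{(\alpha+1)}=q_{m+1}^{(\alpha)}e_m^{(\alpha)}\quad(1\le m\le n-1,\ \alpha\ge0),$$ $$e_0^{(\alpha)}=e_n^{(\alpha)}=\mathbb{O}_p\quad(\alpha\ge0).$$ It is assumed that the algorithm can be carried out for all $\alpha$, i.e. $q_m^{(\alpha+1)}$ is invertible for $1\le m\le n-1$ and all $\alpha\ge 0$ (so $e_m^{(\alpha+\theta)}=q_{m+1}^{(\alpha)}e_m^{(\alpha)}(q_m^{(\alpha+1)})^{-1}$). $\mathscr{R}_n^{(\alpha)}$ is the $n\times n$ block upper bidiagonal matrix (blocks $p\times p$) with diagonal blocks $q_1^{(\alpha)},\dots,q_n^{(\alpha)}$ and all superdiagonal blocks $\mathbb{I}_p$. $\mathscr{L}_n^{(\alpha)}$ is the $n\times n$ block lower bidiagonal matrix with diagonal blocks $\mathbb{I}_p$ and subdiagonal blocks $e_1^{(\alpha)},\dots,e_{n-1}^{(\alpha)}$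 (with $e_m^{(\alpha)}$ in block position $(m+1,m)$). The $n-1$ leading (dominant) principal block minors of an $np\times np$ matrix are the determinants of its leading $kp\times kp$ submatrices, $k=1,\dots,n-1$. *)

theory Defs
  imports
    Complex_Main
    "Jordan_Normal_Form.Char_Poly"
    "Jordan_Normal_Form.DL_Submatrix"
begin

text \<open>
  Matrices are those of Jordan Normal Form, whose entries are indexed from 0. Block indices and the
  lower index of \<open>q\<close> and \<open>e\<close> are counted from 1; \<open>q m \<alpha>\<close> and \<open>e m \<alpha>\<close> stand for $q_m^{(\alpha)}$ and
  $e_m^{(\alpha)}$.
\<close>

text \<open>
  The invertibility clause expresses that the algorithm does not break down: it makes the second
  recurrence equivalent to $e_m^{(\alpha+\theta)} = q_{m+1}^{(\alpha)} e_m^{(\alpha)} (q_m^{(\alpha+1)})^{-1}$.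
  The initial matrices $q_m^{(0)}$ are not required to be invertible.
\<close>

definition block_qd ::
  "nat \<Rightarrow> nat \<Rightarrow> nat \<Rightarrow> (nat \<Rightarrow> nat \<Rightarrow> real mat) \<Rightarrow> (nat \<Rightarrow> nat \<Rightarrow> real mat) \<Rightarrow> bool" where
  "block_qd n p \<theta> q e \<longleftrightarrow>
     (\<forall>\<alpha>. \<forall>m\<in>{1..n}. q m \<alpha> \<in> carrier_mat p p) \<and>
     (\<forall>\<alpha>. \<forall>m\<in>{0..n}. e m \<alpha> \<in> carrier_mat p p) \<and>
     (\<forall>\<alpha>. \<forall>m\<in>{1..n}. q m (\<alpha> + 1) + e (m - 1) (\<alpha> + \<theta>) = q m \<alpha> + e m \<alpha>) \<and>
     (\<forall>\<alpha>. \<forall>m\<in>{1..<n}. e m (\<alpha> + \<theta>) * q m (\<alpha> + 1) = q (m + 1) \<alpha> * e m \<alpha>) \<and>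
     (\<forall>\<alpha>. e 0 \<alpha> = 0\<^sub>m p p \<and> e n \<alpha> = 0\<^sub>m p p) \<and>
     (\<forall>\<alpha>. \<forall>m\<in>{1..<n}. invertible_mat (q m (\<alpha> + 1)))"

definition block_mat :: "nat \<Rightarrow> nat \<Rightarrow> (nat \<Rightarrow> nat \<Rightarrow> 'a mat) \<Rightarrow> 'a mat" where
  "block_mat n p B =
     mat (n * p) (n * p) (\<lambda>(i, j). B (i div p + 1) (j div p + 1) $$ (i mod p, j mod p))"

definition block_upper_bidiag :: "nat \<Rightarrow> nat \<Rightarrow> (nat \<Rightarrow> real mat) \<Rightarrow> real mat" where
  "block_upper_bidiag n p d =
     block_mat n p (\<lambda>k l. if k = l then d k else if l = k + 1 then 1\<^sub>m p else 0\<^sub>m p p)"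

definition block_lower_bidiag :: "nat \<Rightarrow> nat \<Rightarrow> (nat \<Rightarrow> real mat) \<Rightarrow> real mat" where
  "block_lower_bidiag n p s =
     block_mat n p (\<lambda>k l. if k = l then 1\<^sub>m p else if k = l + 1 then s l else 0\<^sub>m p p)"

definition R_mat :: "nat \<Rightarrow> nat \<Rightarrow> (nat \<Rightarrow> nat \<Rightarrow> real mat) \<Rightarrow> nat \<Rightarrow> real mat" where
  "R_mat n p q \<alpha> = block_upper_bidiag n p (\<lambda>m. q m \<alpha>)"

definition L_mat :: "nat \<Rightarrow> nat \<Rightarrow> (nat \<Rightarrow> nat \<Rightarrow> real mat) \<Rightarrow> nat \<Rightarrow> real mat" where
  "L_mat n p e \<alpha> = block_lower_bidiag n p (\<lambda>m. e m \<alpha>)"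

definition J_mat ::
  "nat \<Rightarrow> nat \<Rightarrow> nat \<Rightarrow> (nat \<Rightarrow> nat \<Rightarrow> real mat) \<Rightarrow> (nat \<Rightarrow> nat \<Rightarrow> real mat) \<Rightarrow> nat \<Rightarrow> real mat" where
  "J_mat n p \<theta> q e \<alpha> = foldr (*) (map (L_mat n p e) [\<alpha>..<\<alpha> + \<theta>]) (R_mat n p q \<alpha>)"

definition leading_block_minor :: "nat \<Rightarrow> nat \<Rightarrow> 'a::comm_ring_1 mat \<Rightarrow> 'a" where
  "leading_block_minor p k A = det (submatrix A {..<k * p} {..<k * p})"

text \<open>
  The type of matrices of arbitrary dimensions carries no topology, so convergence is stated
  entrywise, for matrices that all have the dimensions of the limit.
\<close>

definition mat_LIMSEQ :: "(nat \<Rightarrow> 'a::topological_space mat) \<Rightarrow> 'a mat \<Rightarrow> bool" where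
  "mat_LIMSEQ A M \<longleftrightarrow>
     (\<forall>k. A k \<in> carrier_mat (dim_row M) (dim_col M)) \<and>
     (\<forall>i<dim_row M. \<forall>j<dim_col M. (\<lambda>k. A k $$ (i, j)) \<longlonglongrightarrow> M $$ (i, j))"

end

theory Submission
  imports Defs
begin

text \<open>
  The recurrences say \<open>L(\<alpha>+\<theta>) R(\<alpha>+1) = R(\<alpha>) L(\<alpha>)\<close>. With \<open>P(\<alpha>) = L(0) \<dots> L(\<alpha>-1)\<close> they give
  \<open>P(\<alpha>) J(\<alpha>) = J(0) P(\<alpha>)\<close>, and \<open>J(0)^k = P(\<theta>k) U(k)\<close> is a block LU decomposition of the power. Expanding
  \<open>J(0)^k = X D^k X^-1\<close> through the block LU decompositions of \<open>X\<close> and \<open>X^-1\<close>, the distinct moduli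
  force \<open>P(\<theta>k)\<close> to converge to the lower factor \<open>K\<close> of \<open>X\<close>. Hence \<open>J(\<theta>k)\<close> converges to
  \<open>K^-1 J(0) K\<close>, and so does \<open>R(\<theta>k)\<close>, because \<open>P(\<theta>(k+1)) R(\<theta>k) = J(0) P(\<theta>k)\<close>. The common limit is thus
  block upper bidiagonal.
\<close>

section \<open>Block triangular matrices\<close>

lemma mult_mat_index_sum:
  assumes "A \<in> carrier_mat nr N" "B \<in> carrier_mat N nc" "i < nr" "j < nc"
  shows "(A * B) $$ (i, j) = (\<Sum>k<N. A $$ (i, k) * B $$ (k, j))"
  using assms by (auto simp: scalar_prod_def atLeast0LessThan)

lemma det_nonzero_inverse_exists:
  fixes A :: "'a::field mat"
  assumes A: "A \<in> carrier_mat N N" and "det A \<noteq> 0"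
  shows "\<exists>B\<in>carrier_mat N N. A * B = 1\<^sub>m N \<and> B * A = 1\<^sub>m N"
  using det_non_zero_imp_unit[OF assms, where b = "()"]
  unfolding Units_def by (auto simp: ring_mat_simps)

text \<open>The diagonal blocks of a block unit lower triangular matrix are identities, so it is also lower
  triangular in the ordinary sense.\<close>

definition block_unit_lower :: "nat \<Rightarrow> nat \<Rightarrow> 'a::zero_neq_one mat \<Rightarrow> bool" where
  "block_unit_lower N p A \<longleftrightarrow> A \<in> carrier_mat N N \<and>
     (\<forall>i<N. \<forall>j<N. i div p \<le> j div p \<longrightarrow> A $$ (i, j) = (if i = j then 1 else 0))"

definition block_upper :: "nat \<Rightarrow> nat \<Rightarrow> 'a::zero mat \<Rightarrow> bool" where
  "block_upper N p A \<longleftrightarrow> A \<in> carrier_mat N N \<and>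
     (\<forall>i<N. \<forall>j<N. j div p < i div p \<longrightarrow> A $$ (i, j) = 0)"

lemma block_unit_lower_carrier: "block_unit_lower N p A \<Longrightarrow> A \<in> carrier_mat N N"
  by (simp add: block_unit_lower_def)

lemma block_upper_carrier: "block_upper N p A \<Longrightarrow> A \<in> carrier_mat N N"
  by (simp add: block_upper_def)

lemma block_unit_lower_index:
  "block_unit_lower N p A \<Longrightarrow> i < N \<Longrightarrow> j < N \<Longrightarrow> i div p \<le> j div p
    \<Longrightarrow> A $$ (i, j) = (if i = j then 1 else 0)"
  by (simp add: block_unit_lower_def)

lemma block_upper_index:
  "block_upper N p A \<Longrightarrow> i < N \<Longrightarrow> j < N \<Longrightarrow> j div p < i div p \<Longrightarrow> A $$ (i, j) = 0"
  by (simp add: block_upper_def)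

lemma block_unit_lower_one [simp]: "block_unit_lower N p (1\<^sub>m N)"
  by (auto simp: block_unit_lower_def)

lemma block_upper_mult:
  assumes A: "block_upper N p A" and B: "block_upper N p (B :: 'a::semiring_0 mat)"
  shows "block_upper N p (A * B)"
  unfolding block_upper_def
proof (intro conjI allI impI)
  show "A * B \<in> carrier_mat N N"
    using block_upper_carrier[OF A] block_upper_carrier[OF B] by auto
  fix i j assume ij: "i < N" "j < N" "j div p < i div p"
  have "A $$ (i, k) * B $$ (k, j) = 0" if "k < N" for k
    using block_upper_index[OF A ij(1) that] block_upper_index[OF B that ij(2)] ij(3)
    by (cases "k div p < i div p") auto
  then show "(A * B) $$ (i, j) = 0"
    by (simp add: mult_mat_index_sum[OF block_upper_carrier[OF A] block_upper_carrier[OF B] ij(1,2)])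
qed

text \<open>An index beyond \<open>i\<close> lies in the same or a later block, so row
  \<open>i\<close> of \<open>G\<close> vanishes to the right of its diagonal entry 1. Solved for row
  \<open>i\<close> of \<open>Z\<close>, this is forward substitution, on which the inverse and the
  limit arguments below rest.\<close>

lemma block_unit_lower_mult_index:
  fixes G Z :: "'a::comm_ring_1 mat"
  assumes G: "block_unit_lower N p G" and Z: "Z \<in> carrier_mat N nc" and "i < N" "j < nc"
  shows "(G * Z) $$ (i, j) = Z $$ (i, j) + (\<Sum>k<i. G $$ (i, k) * Z $$ (k, j))"
proof -
  let ?t = "\<lambda>k. G $$ (i, k) * Z $$ (k, j)"
  have "(G * Z) $$ (i, j) = sum ?t {..<N}"
    by (rule mult_mat_index_sum[OF block_unit_lower_carrier[OF G] Z assms(3,4)])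
  also have "\<dots> = sum ?t {..i}"
  proof (rule sum.mono_neutral_right)
    show "\<forall>k\<in>{..<N} - {..i}. ?t k = 0"
      using block_unit_lower_index[OF G \<open>i < N\<close>] by (auto simp: not_le div_le_mono)
  qed (use \<open>i < N\<close> in auto)
  also have "\<dots> = sum ?t {..<i} + ?t i"
    by (simp add: lessThan_Suc_atMost[symmetric])
  finally show ?thesis
    using block_unit_lower_index[OF G \<open>i < N\<close> \<open>i < N\<close>] by simp
qed

lemma block_unit_lower_mult:
  fixes A B :: "'a::comm_ring_1 mat"
  assumes A: "block_unit_lower N p A" and B: "block_unit_lower N p B"
  shows "block_unit_lower N p (A * B)"
  unfolding block_unit_lower_def
proof (intro conjI allI impI)
  show "A * B \<in> carrier_mat N N"
    using block_unit_lower_carrier[OF A] block_unit_lower_carrier[OF B] by auto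
  fix i j assume ij: "i < N" "j < N" "i div p \<le> j div p"
  \<comment> \<open>Either \<open>k\<close> is in an earlier block than \<open>i\<close>, hence than
    \<open>j\<close>, and the entry of \<open>B\<close> vanishes, or \<open>k\<close> shares the
    block of \<open>i\<close> and the entry of \<open>A\<close> does.\<close>
  have "A $$ (i, k) * B $$ (k, j) = 0" if "k < i" for k
  proof (cases "k div p < i div p")
    case True
    then have "k \<noteq> j" "k div p \<le> j div p" using ij(3) by auto
    then show ?thesis using block_unit_lower_index[OF B _ ij(2), of k] that ij(1) by simp
  next
    case False
    then show ?thesis using block_unit_lower_index[OF A ij(1), of k] that ij(1) by simp
  qed
  then show "(A * B) $$ (i, j) = (if i = j then 1 else 0)"
    using block_unit_lower_mult_index[OF A block_unit_lower_carrier[OF B] ij(1,2)]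
      block_unit_lower_index[OF B ij] by simp
qed

lemma block_unit_lower_inverse:
  fixes L :: "'a::field mat"
  assumes L: "block_unit_lower N p L"
  shows "\<exists>M. block_unit_lower N p M \<and> M * L = 1\<^sub>m N"
proof -
  have Lc: "L \<in> carrier_mat N N" by (rule block_unit_lower_carrier[OF L])
  have "det L = prod_list (diag_mat L)"
  proof (rule det_lower_triangular[OF _ Lc])
    fix i j assume "i < j" "j < N"
    then show "L $$ (i, j) = 0"
      using block_unit_lower_index[OF L, of i j] by (simp add: div_le_mono)
  qed
  also have "\<dots> = 1"
    using Lc block_unit_lower_index[OF L] by (simp add: prod_list_diag_prod)
  finally obtain M where M: "M \<in> carrier_mat N N" "L * M = 1\<^sub>m N" "M * L = 1\<^sub>m N"
    using det_nonzero_inverse_exists[OF Lc] by auto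
  \<comment> \<open>The determinant 1 only provides an inverse; its block shape follows from
    \<open>L * M = 1\<close> by forward substitution down the rows, with the column \<open>j\<close>
    fixed.\<close>
  have "M $$ (i, j) = (if i = j then 1 else 0)" if "i < N" "j < N" "i div p \<le> j div p" for i j
    using that(1,3)
  proof (induction i rule: less_induct)
    case (less i)
    have "L $$ (i, k) * M $$ (k, j) = 0" if "k < i" for k
    proof (cases "k div p < i div p")
      case True
      then have "k \<noteq> j" "k div p \<le> j div p" using less.prems by auto
      then show ?thesis using less.IH[OF that] that less.prems(1) by simp
    next
      case False
      then show ?thesis using block_unit_lower_index[OF L less.prems(1), of k] that less.prems(1) by simp
    qed
    then have "(\<Sum>k<i. L $$ (i, k) * M $$ (k, j)) = 0" by (intro sum.neutral) auto
    then show ?case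
      using block_unit_lower_mult_index[OF L M(1) less.prems(1) \<open>j < N\<close>] less.prems(1) \<open>j < N\<close>
      by (simp add: M(2))
  qed
  then show ?thesis using M by (auto simp: block_unit_lower_def)
qed

section \<open>Leading submatrices and block LU decomposition\<close>

lemma pick_lessThan: "i < m \<Longrightarrow> pick {..<m} i = i"
proof (induction i)
  case 0
  then show ?case by (auto intro!: Least_equality)
next
  case (Suc i)
  then show ?case by (auto intro!: Least_equality)
qed

lemma submatrix_lessThan:
  assumes "A \<in> carrier_mat N N" "m \<le> N"
  shows "submatrix A {..<m} {..<m} = mat m m (\<lambda>(i, j). A $$ (i, j))"
proof -
  have "{i. i < N \<and> i < m} = {..<m}" using assms by auto
  then show ?thesis
    using assms unfolding submatrix_def by (intro eq_matI) (auto simp: pick_lessThan)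
qed

text \<open>This is a block LU decomposition of \<open>A\<close>, with the upper factor given by its inverse \<open>W\<close>: column
  \<open>j\<close> of \<open>W\<close> is a column of the inverse of the leading submatrix of \<open>A\<close> that ends with the block
  of \<open>j\<close>.\<close>

lemma block_lower_factor_exists:
  fixes A :: "'a::field mat"
  assumes A: "A \<in> carrier_mat (n * p) (n * p)" and "det A \<noteq> 0"
    and minors: "\<And>k. k \<in> {1..<n} \<Longrightarrow> leading_block_minor p k A \<noteq> 0"
  shows "\<exists>W. block_upper (n * p) p W \<and> block_unit_lower (n * p) p (A * W)"
proof -
  let ?N = "n * p"
  have "\<exists>B\<in>carrier_mat (k * p) (k * p). mat (k * p) (k * p) (\<lambda>(i, j). A $$ (i, j)) * B = 1\<^sub>m (k * p)"
    if "k \<in> {1..n}" for k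
  proof -
    \<comment> \<open>The minors cover \<open>k < n\<close>; for \<open>k = n\<close> the leading
      submatrix is \<open>A\<close> itself.\<close>
    have "det (mat (k * p) (k * p) (\<lambda>(i, j). A $$ (i, j))) \<noteq> 0"
    proof (cases "k = n")
      case True
      then have "mat (k * p) (k * p) (\<lambda>(i, j). A $$ (i, j)) = A" using A by auto
      then show ?thesis using \<open>det A \<noteq> 0\<close> by simp
    next
      case False
      then show ?thesis
        using minors[of k] that submatrix_lessThan[OF A, of "k * p"]
        by (simp add: leading_block_minor_def)
    qed
    from det_nonzero_inverse_exists[OF _ this, of "k * p"] show ?thesis by auto
  qed
  then obtain B where B: "\<And>k. k \<in> {1..n} \<Longrightarrow> B k \<in> carrier_mat (k * p) (k * p)"
    "\<And>k. k \<in> {1..n} \<Longrightarrow> mat (k * p) (k * p) (\<lambda>(i, j). A $$ (i, j)) * B k = 1\<^sub>m (k * p)"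
    by metis
  \<comment> \<open>\<open>bl j\<close> is the number, counted from 1, of the block containing
    \<open>j\<close>, so \<open>bl j * p\<close> is the size of the leading submatrix that ends with
    this block.\<close>
  define bl where "bl j = Suc (j div p)" for j
  define W where "W = mat ?N ?N (\<lambda>(i, j). if i < bl j * p then B (bl j) $$ (i, j) else 0)"
  have p: "p > 0" if "j < ?N" for j using that by (cases p) auto
  have bl: "bl j \<in> {1..n}" if "j < ?N" for j
    using that by (simp add: bl_def less_mult_imp_div_less Suc_leI)
  have less_bl: "i < bl j * p \<longleftrightarrow> i div p \<le> j div p" if "j < ?N" for i j
    using p[OF that] by (simp add: bl_def div_less_iff_less_mult[symmetric] less_Suc_eq_le del: mult_Suc)
  have W: "W \<in> carrier_mat ?N ?N" by (simp add: W_def)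
  have "block_upper ?N p W"
    unfolding block_upper_def using less_bl by (auto simp: W_def)
  moreover have "(A * W) $$ (i, j) = (if i = j then 1 else 0)"
    if ij: "i < ?N" "j < ?N" "i div p \<le> j div p" for i j
  proof -
    let ?m = "bl j * p"
    have m: "?m \<le> ?N" using bl[OF ij(2)] by (intro mult_right_mono) auto
    have im: "i < ?m" and jm: "j < ?m" using less_bl[OF ij(2)] ij(3) by auto
    have "(A * W) $$ (i, j) = (\<Sum>k<?N. A $$ (i, k) * W $$ (k, j))"
      by (rule mult_mat_index_sum[OF A W ij(1,2)])
    \<comment> \<open>Column \<open>j\<close> of \<open>W\<close> is zero from row \<open>?m\<close>
      on, so only the leading submatrix contributes to the rows above \<open>?m\<close>, where the
      product is a column of the identity.\<close>
    also have "\<dots> = (\<Sum>k<?m. A $$ (i, k) * W $$ (k, j))"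
      using m ij by (intro sum.mono_neutral_right) (auto simp: W_def)
    also have "\<dots> = (\<Sum>k<?m. mat ?m ?m (\<lambda>(i, j). A $$ (i, j)) $$ (i, k) * B (bl j) $$ (k, j))"
    proof (rule sum.cong[OF refl])
      fix k assume "k \<in> {..<?m}"
      then have "k < ?m" "k < ?N" using less_le_trans[OF _ m] by auto
      then show "A $$ (i, k) * W $$ (k, j) = mat ?m ?m (\<lambda>(i, j). A $$ (i, j)) $$ (i, k) * B (bl j) $$ (k, j)"
        using ij(2) im by (simp add: W_def)
    qed
    also have "\<dots> = (mat ?m ?m (\<lambda>(i, j). A $$ (i, j)) * B (bl j)) $$ (i, j)"
      by (rule mult_mat_index_sum[symmetric, OF _ B(1)[OF bl[OF ij(2)]] im jm]) simp
    also have "\<dots> = (if i = j then 1 else 0)"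
      using B(2)[OF bl[OF ij(2)]] im jm by simp
    finally show ?thesis .
  qed
  ultimately show ?thesis
    using A W by (intro exI[of _ W]) (auto simp: block_unit_lower_def)
qed

section \<open>Entrywise limits\<close>

lemma mat_LIMSEQ_iff:
  assumes "M \<in> carrier_mat nr nc"
  shows "mat_LIMSEQ A M \<longleftrightarrow> (\<forall>k. A k \<in> carrier_mat nr nc) \<and>
    (\<forall>i<nr. \<forall>j<nc. (\<lambda>k. A k $$ (i, j)) \<longlonglongrightarrow> M $$ (i, j))"
  using assms by (auto simp: mat_LIMSEQ_def)

lemma mat_LIMSEQ_const: "mat_LIMSEQ (\<lambda>k. A) A"
  by (simp add: mat_LIMSEQ_def)

lemma mat_LIMSEQ_mult:
  fixes A B :: "nat \<Rightarrow> 'a::real_normed_field mat"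
  assumes "mat_LIMSEQ A M" "mat_LIMSEQ B M'" "M \<in> carrier_mat nr N" "M' \<in> carrier_mat N nc"
  shows "mat_LIMSEQ (\<lambda>k. A k * B k) (M * M')"
proof -
  have A: "A k \<in> carrier_mat nr N" and B: "B k \<in> carrier_mat N nc" for k
    using assms by (auto simp: mat_LIMSEQ_iff)
  have *: "M * M' \<in> carrier_mat nr nc" using assms by auto
  show ?thesis
    unfolding mat_LIMSEQ_iff[OF *]
  proof (intro conjI allI impI)
    show "A k * B k \<in> carrier_mat nr nc" for k using A B by (rule mult_carrier_mat)
    fix i j assume ij: "i < nr" "j < nc"
    show "(\<lambda>k. (A k * B k) $$ (i, j)) \<longlonglongrightarrow> (M * M') $$ (i, j)"
      unfolding mult_mat_index_sum[OF A B ij] mult_mat_index_sum[OF assms(3,4) ij]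
      using assms ij by (intro tendsto_sum tendsto_mult) (auto simp: mat_LIMSEQ_iff)
  qed
qed

text \<open>By forward substitution, row \<open>i\<close> of \<open>Z k\<close> is row
  \<open>i\<close> of \<open>G k * Z k\<close> minus a combination of earlier rows of
  \<open>Z k\<close>, which converge by induction, with coefficients that tend to 0.\<close>

lemma block_unit_lower_LIMSEQ_cancel:
  fixes G Z :: "nat \<Rightarrow> 'a::real_normed_field mat"
  assumes G: "\<And>k. block_unit_lower N p (G k)" "mat_LIMSEQ G (1\<^sub>m N)"
    and Z: "\<And>k. Z k \<in> carrier_mat N N" and Y: "Y \<in> carrier_mat N N"
    and GZ: "mat_LIMSEQ (\<lambda>k. G k * Z k) Y"
  shows "mat_LIMSEQ Z Y"
proof -
  have "(\<lambda>k. Z k $$ (i, j)) \<longlonglongrightarrow> Y $$ (i, j)" if "i < N" "j < N" for i j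
    using that(1)
  proof (induction i rule: less_induct)
    case (less i)
    have "(\<lambda>k. (G k * Z k) $$ (i, j) - (\<Sum>b<i. G k $$ (i, b) * Z k $$ (b, j)))
        \<longlonglongrightarrow> Y $$ (i, j) - (\<Sum>b<i. 0 * Y $$ (b, j))"
    proof (intro tendsto_diff tendsto_sum tendsto_mult)
      show "(\<lambda>k. (G k * Z k) $$ (i, j)) \<longlonglongrightarrow> Y $$ (i, j)"
        using GZ less.prems \<open>j < N\<close> by (simp add: mat_LIMSEQ_iff[OF Y])
      show "(\<lambda>k. G k $$ (i, b)) \<longlonglongrightarrow> 0" if "b \<in> {..<i}" for b
      proof -
        have "(\<lambda>k. G k $$ (i, b)) \<longlonglongrightarrow> 1\<^sub>m N $$ (i, b)"
          using G(2) that less.prems by (auto simp: mat_LIMSEQ_iff[OF one_carrier_mat] simp del: index_one_mat)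
        moreover have "1\<^sub>m N $$ (i, b) = (0 :: 'a)" using that less.prems by simp
        ultimately show ?thesis by simp
      qed
      show "(\<lambda>k. Z k $$ (b, j)) \<longlonglongrightarrow> Y $$ (b, j)" if "b \<in> {..<i}" for b
        using less.IH[of b] that less.prems by auto
    qed
    then show ?case
      by (simp add: block_unit_lower_mult_index[OF G(1) Z less.prems \<open>j < N\<close>])
  qed
  then show ?thesis using Z by (simp add: mat_LIMSEQ_iff[OF Y])
qed

text \<open>Once \<open>v k\<close> is close to the identity, the 1-norm of the row
  \<open>g k\<close> is at most twice that of the row \<open>g k\<close> times \<open>v k\<close>.
  This needs no prior bound on \<open>g\<close>.\<close>

lemma row_tendsto_zero:
  fixes g :: "nat \<Rightarrow> 'b \<Rightarrow> 'a::real_normed_field"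
  assumes S: "finite S"
    and v: "\<And>b c. b \<in> S \<Longrightarrow> c \<in> S \<Longrightarrow> (\<lambda>k. v k b c) \<longlonglongrightarrow> (if b = c then 1 else 0)"
    and gv: "\<And>c. c \<in> S \<Longrightarrow> (\<lambda>k. \<Sum>b\<in>S. g k b * v k b c) \<longlonglongrightarrow> 0"
    and b: "b \<in> S"
  shows "(\<lambda>k. g k b) \<longlonglongrightarrow> 0"
proof -
  let ?\<delta> = "\<lambda>b c. (if b = c then 1 else 0 :: 'a)"
  let ?h = "\<lambda>k c. \<Sum>b\<in>S. g k b * v k b c"
  \<comment> \<open>With this \<epsilon>, the errors of all columns add up to at most half of the
    1-norm of \<open>g k\<close>, which is absorbed into the left-hand side.\<close>
  define \<epsilon> where "\<epsilon> = 1 / (2 * real (card S))"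
  have "card S > 0" using S b card_gt_0_iff by blast
  then have "\<epsilon> > 0" by (simp add: \<epsilon>_def)
  have "eventually (\<lambda>k. \<forall>b\<in>S. \<forall>c\<in>S. norm (v k b c - ?\<delta> b c) < \<epsilon>) sequentially"
    using tendstoD[OF v \<open>\<epsilon> > 0\<close>] S by (auto simp: eventually_ball_finite_distrib dist_norm)
  then have ev: "eventually (\<lambda>k. (\<Sum>c\<in>S. norm (g k c)) \<le> 2 * (\<Sum>c\<in>S. norm (?h k c))) sequentially"
  proof (eventually_elim)
    case (elim k)
    have "norm (g k c) \<le> norm (?h k c) + (\<Sum>b\<in>S. norm (g k b)) * \<epsilon>" if c: "c \<in> S" for c
    proof -
      have "(\<Sum>b\<in>S. g k b * (v k b c - ?\<delta> b c)) = ?h k c - (\<Sum>b\<in>S. g k b * ?\<delta> b c)"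
        by (simp only: right_diff_distrib sum_subtractf)
      also have "(\<Sum>b\<in>S. g k b * ?\<delta> b c) = g k c"
        using S c by (simp add: if_distrib cong: if_cong)
      finally have "g k c = ?h k c - (\<Sum>b\<in>S. g k b * (v k b c - ?\<delta> b c))" by simp
      then have "norm (g k c) \<le> norm (?h k c) + norm (\<Sum>b\<in>S. g k b * (v k b c - ?\<delta> b c))"
        by (metis norm_triangle_ineq4)
      also have "norm (\<Sum>b\<in>S. g k b * (v k b c - ?\<delta> b c)) \<le> (\<Sum>b\<in>S. norm (g k b) * \<epsilon>)"
      proof (rule sum_norm_le)
        fix b assume "b \<in> S"
        then have "norm (v k b c - ?\<delta> b c) \<le> \<epsilon>" using elim c by (meson less_imp_le)
        then show "norm (g k b * (v k b c - ?\<delta> b c)) \<le> norm (g k b) * \<epsilon>"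
          unfolding norm_mult by (intro mult_left_mono) auto
      qed
      finally show ?thesis by (simp add: sum_distrib_right)
    qed
    then have "(\<Sum>c\<in>S. norm (g k c)) \<le> (\<Sum>c\<in>S. norm (?h k c) + (\<Sum>b\<in>S. norm (g k b)) * \<epsilon>)"
      by (rule sum_mono)
    also have "\<dots> = (\<Sum>c\<in>S. norm (?h k c)) + (\<Sum>b\<in>S. norm (g k b)) / 2"
      using \<open>card S > 0\<close> by (simp add: sum.distrib \<epsilon>_def)
    finally show ?case by simp
  qed
  have "(\<lambda>k. 2 * (\<Sum>c\<in>S. norm (?h k c))) \<longlonglongrightarrow> 2 * (\<Sum>c\<in>S. 0)"
    by (intro tendsto_intros tendsto_norm_zero gv)
  then have lim: "(\<lambda>k. 2 * (\<Sum>c\<in>S. norm (?h k c))) \<longlonglongrightarrow> 0" by simp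
  have "norm (g k b) \<le> (\<Sum>c\<in>S. norm (g k c))" for k
    using S b by (intro member_le_sum) auto
  with ev have "eventually (\<lambda>k. norm (g k b) \<le> 2 * (\<Sum>c\<in>S. norm (?h k c))) sequentially"
    by (elim eventually_mono) (meson order_trans)
  then have "eventually (\<lambda>k. norm (g k b) \<le> norm (2 * (\<Sum>c\<in>S. norm (?h k c))) * 1) sequentially"
    by (elim eventually_mono) auto
  then show ?thesis by (rule tendsto_0_le[OF lim])
qed

text \<open>Nothing is assumed about the last block column of the limit, because the last eigenvalue
  may be zero; the last block column of a block unit lower triangular matrix is fixed anyway.\<close>

lemma block_lower_upper_LIMSEQ:
  fixes G V F :: "nat \<Rightarrow> 'a::real_normed_field mat"
  assumes G: "\<And>k. block_unit_lower (n * p) p (G k)"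
    and V: "\<And>k. block_upper (n * p) p (V k)"
    and F: "\<And>a c. a < n * p \<Longrightarrow> c < n * p \<Longrightarrow> Suc (c div p) < n \<Longrightarrow>
      (\<lambda>k. (G k * V k) $$ (a, c)) \<longlonglongrightarrow> (if a = c then 1 else 0)"
  shows "mat_LIMSEQ G (1\<^sub>m (n * p))"
proof -
  let ?N = "n * p" and ?\<delta> = "\<lambda>a c. (if a = c then 1 else 0 :: 'a)"
  note Gc = block_unit_lower_carrier[OF G] and Vc = block_upper_carrier[OF V]
  have fixed: "(\<lambda>k. G k $$ (a, c)) \<longlonglongrightarrow> ?\<delta> a c" if "a < ?N" "c < ?N" "a div p \<le> c div p" for a c
    using that by (simp only: block_unit_lower_index[OF G] tendsto_const)
  \<comment> \<open>Induction over the block columns: the limits of \<open>G\<close> in columns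
    before block \<open>J\<close> give those of block column \<open>J\<close> of \<open>V\<close>
    down to its diagonal block, and these in turn give block column \<open>J\<close> of
    \<open>G\<close>.\<close>
  have cols: "(\<lambda>k. G k $$ (a, c)) \<longlonglongrightarrow> ?\<delta> a c"
    if "Suc J < n" "c div p = J" "c < ?N" "a < ?N" for J a c
    using that
  proof (induction J arbitrary: a c rule: less_induct)
    case (less J)
    note IH = less.IH
    \<comment> \<open>Forward substitution again: for row \<open>a\<close> in a block up to
      \<open>J\<close>, the entries of \<open>G\<close> left of the diagonal lie in the block of
      \<open>a\<close>, where they are fixed, or in a block column before \<open>J\<close>, where
      the outer induction applies.\<close>
    have Vlim: "(\<lambda>k. V k $$ (a, c)) \<longlonglongrightarrow> ?\<delta> a c"
      if "a < ?N" "a div p \<le> J" and c: "c < ?N" "c div p = J" for a c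
      using that(1,2)
    proof (induction a rule: less_induct)
      case (less a)
      have "(\<lambda>k. (G k * V k) $$ (a, c) - (\<Sum>b<a. G k $$ (a, b) * V k $$ (b, c)))
        \<longlonglongrightarrow> ?\<delta> a c - (\<Sum>b<a. 0 * ?\<delta> b c)"
      proof (intro tendsto_diff tendsto_sum tendsto_mult)
        show "(\<lambda>k. (G k * V k) $$ (a, c)) \<longlonglongrightarrow> ?\<delta> a c"
          using F[OF less.prems(1) c(1)] c(2) \<open>Suc J < n\<close> by simp
        fix b assume "b \<in> {..<a}"
        then have b: "b < a" "b < ?N" "b div p \<le> a div p" using less.prems by (auto simp: div_le_mono)
        have "(\<lambda>k. G k $$ (a, b)) \<longlonglongrightarrow> ?\<delta> a b"
        proof (cases "b div p < a div p")
          case True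
          then show ?thesis
            using less.prems \<open>Suc J < n\<close> b
            by (intro IH[OF _ _ refl]) auto
        next
          case False
          then show ?thesis using b less.prems by (intro fixed) auto
        qed
        then show "(\<lambda>k. G k $$ (a, b)) \<longlonglongrightarrow> 0" using b by simp
        show "(\<lambda>k. V k $$ (b, c)) \<longlonglongrightarrow> ?\<delta> b c"
          using b less.prems by (intro less.IH) auto
      qed
      then show ?case
        by (simp add: block_unit_lower_mult_index[OF G Vc less.prems(1) c(1)])
    qed
    show ?case
    proof (cases "a div p \<le> c div p")
      case True
      then show ?thesis using less.prems by (intro fixed) auto
    next
      case False
      \<comment> \<open>\<open>?S\<close> is block \<open>J\<close> and \<open>?S'\<close> the union
        of the earlier blocks. Later blocks drop out because \<open>V k\<close> is block upper
        triangular, so row \<open>a\<close> of \<open>G k\<close>, cut down to \<open>?S\<close>, is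
        multiplied by a diagonal block of \<open>V k\<close> that tends to the identity.\<close>
      let ?S = "{b. b < ?N \<and> b div p = J}" and ?S' = "{b. b < ?N \<and> b div p < J}"
      have "(\<lambda>k. G k $$ (a, c)) \<longlonglongrightarrow> 0"
      proof (rule row_tendsto_zero[where S = ?S and v = "\<lambda>k b c. V k $$ (b, c)"])
        show "(\<lambda>k. V k $$ (b, c)) \<longlonglongrightarrow> ?\<delta> b c" if "b \<in> ?S" "c \<in> ?S" for b c
          using that by (intro Vlim) auto
        fix c assume c: "c \<in> ?S"
        have split: "(\<Sum>b\<in>?S. G k $$ (a, b) * V k $$ (b, c)) =
          (G k * V k) $$ (a, c) - (\<Sum>b\<in>?S'. G k $$ (a, b) * V k $$ (b, c))" for k
        proof -
          have "(G k * V k) $$ (a, c) = (\<Sum>b<?N. G k $$ (a, b) * V k $$ (b, c))"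
            using c less.prems by (intro mult_mat_index_sum[OF Gc Vc]) auto
          also have "\<dots> = (\<Sum>b\<in>?S \<union> ?S'. G k $$ (a, b) * V k $$ (b, c))"
            using c by (intro sum.mono_neutral_right) (auto intro!: block_upper_index[OF V])
          also have "\<dots> = (\<Sum>b\<in>?S. G k $$ (a, b) * V k $$ (b, c)) + (\<Sum>b\<in>?S'. G k $$ (a, b) * V k $$ (b, c))"
            by (intro sum.union_disjoint) auto
          finally show ?thesis by simp
        qed
        have "(\<lambda>k. (G k * V k) $$ (a, c) - (\<Sum>b\<in>?S'. G k $$ (a, b) * V k $$ (b, c)))
          \<longlonglongrightarrow> ?\<delta> a c - (\<Sum>b\<in>?S'. ?\<delta> a b * ?\<delta> b c)"
        proof (intro tendsto_diff tendsto_sum tendsto_mult)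
          show "(\<lambda>k. (G k * V k) $$ (a, c)) \<longlonglongrightarrow> ?\<delta> a c"
            using c less.prems by (intro F) auto
          show "(\<lambda>k. G k $$ (a, b)) \<longlonglongrightarrow> ?\<delta> a b" if "b \<in> ?S'" for b
            using that less.prems by (intro less.IH[OF _ _ refl]) auto
          show "(\<lambda>k. V k $$ (b, c)) \<longlonglongrightarrow> ?\<delta> b c" if "b \<in> ?S'" for b
            using that c by (intro Vlim) auto
        qed
        \<comment> \<open>Row \<open>a\<close> lies in a block after \<open>J\<close>, so it meets
          no diagonal position in \<open>?S\<close> or \<open>?S'\<close> and the whole limit is
          0.\<close>
        moreover have "?\<delta> a c = 0" "\<And>b. b \<in> ?S' \<Longrightarrow> ?\<delta> a b = 0"
          using False less.prems c by auto
        ultimately show "(\<lambda>k. \<Sum>b\<in>?S. G k $$ (a, b) * V k $$ (b, c)) \<longlonglongrightarrow> 0"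
          unfolding split by simp
      qed (use less.prems in auto)
      then show ?thesis using False by auto
    qed
  qed
  have "(\<lambda>k. G k $$ (a, c)) \<longlonglongrightarrow> ?\<delta> a c" if "a < ?N" "c < ?N" for a c
  proof (cases "Suc (c div p) < n")
    case True
    then show ?thesis using cols that by blast
  next
    case False
    moreover have "a div p < n" using that(1) by (rule less_mult_imp_div_less)
    ultimately show ?thesis using that by (intro fixed) auto
  qed
  then show ?thesis using Gc by (simp add: mat_LIMSEQ_iff[OF one_carrier_mat])
qed

section \<open>The Lax form of the block qd-algorithm\<close>

lemma block_mat_carrier: "block_mat n p B \<in> carrier_mat (n * p) (n * p)"
  by (simp add: block_mat_def)

lemma block_mat_index:
  "i < n * p \<Longrightarrow> j < n * p \<Longrightarrow>
    block_mat n p B $$ (i, j) = B (Suc (i div p)) (Suc (j div p)) $$ (i mod p, j mod p)"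
  by (simp add: block_mat_def)

text \<open>The sum over the inner index is cut into \<open>n\<close> runs of length
  \<open>p\<close>, and each run is one product of blocks.\<close>

lemma block_mat_mult_index:
  assumes B: "\<And>k l. k \<in> {1..n} \<Longrightarrow> l \<in> {1..n} \<Longrightarrow> B k l \<in> carrier_mat p p"
    and C: "\<And>k l. k \<in> {1..n} \<Longrightarrow> l \<in> {1..n} \<Longrightarrow> C k l \<in> carrier_mat p p"
    and ij: "i < n * p" "j < n * p"
  shows "(block_mat n p B * block_mat n p C) $$ (i, j) =
    (\<Sum>m\<in>{1..n}. (B (Suc (i div p)) m * C m (Suc (j div p))) $$ (i mod p, j mod p))"
proof -
  let ?k = "Suc (i div p)" and ?l = "Suc (j div p)"
  have p: "p > 0" using ij by (cases p) auto
  have kl: "?k \<in> {1..n}" "?l \<in> {1..n}"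
    using ij by (auto simp: less_mult_imp_div_less Suc_leI)
  let ?f = "\<lambda>t. block_mat n p B $$ (i, t) * block_mat n p C $$ (t, j)"
  have "(block_mat n p B * block_mat n p C) $$ (i, j) = sum ?f {..<n * p}"
    by (rule mult_mat_index_sum[OF block_mat_carrier block_mat_carrier ij])
  also have "\<dots> = (\<Sum>m<n. sum ?f {m * p..<m * p + p})"
    by (rule sum.nat_group[symmetric])
  also have "\<dots> = (\<Sum>m<n. (B ?k (Suc m) * C (Suc m) ?l) $$ (i mod p, j mod p))"
  proof (rule sum.cong[OF refl])
    fix m assume m: "m \<in> {..<n}"
    have "sum ?f {m * p..<m * p + p} = (\<Sum>r<p. ?f (r + m * p))"
      using sum.shift_bounds_nat_ivl[of ?f 0 "m * p" p]
      by (simp add: atLeast0LessThan add.commute)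
    also have "\<dots> = (\<Sum>r<p. B ?k (Suc m) $$ (i mod p, r) * C (Suc m) ?l $$ (r, j mod p))"
    proof (rule sum.cong[OF refl])
      fix r assume r: "r \<in> {..<p}"
      then have "r + m * p < Suc m * p" by simp
      also have "Suc m * p \<le> n * p" using m by (intro mult_le_mono1) auto
      finally show "?f (r + m * p) = B ?k (Suc m) $$ (i mod p, r) * C (Suc m) ?l $$ (r, j mod p)"
        using ij r p by (simp add: block_mat_index)
    qed
    also have "\<dots> = (B ?k (Suc m) * C (Suc m) ?l) $$ (i mod p, j mod p)"
      by (rule mult_mat_index_sum[symmetric, of _ p p _ p]) (use m kl p in \<open>auto intro: B C\<close>)
    finally show "sum ?f {m * p..<m * p + p} = (B ?k (Suc m) * C (Suc m) ?l) $$ (i mod p, j mod p)" .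
  qed
  also have "\<dots> = (\<Sum>m\<in>{1..n}. (B ?k m * C m ?l) $$ (i mod p, j mod p))"
    by (rule sum.reindex_bij_witness[of _ "\<lambda>m. m - 1" Suc]) auto
  finally show ?thesis .
qed

section \<open>Products of block bidiagonal matrices\<close>

lemma block_mod_eq_iff:
  "i div p = j div p \<Longrightarrow> i mod p = j mod p \<longleftrightarrow> i = (j::nat)"
  by (metis div_mult_mod_eq)

lemma block_lower_bidiag_unit_lower: "block_unit_lower (n * p) p (block_lower_bidiag n p s)"
  unfolding block_unit_lower_def
proof (intro conjI allI impI)
  show "block_lower_bidiag n p s \<in> carrier_mat (n * p) (n * p)"
    by (simp add: block_lower_bidiag_def block_mat_carrier)
  fix i j assume ij: "i < n * p" "j < n * p" "i div p \<le> j div p"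
  then have "p > 0" by (cases p) auto
  then show "block_lower_bidiag n p s $$ (i, j) = (if i = j then 1 else 0)"
    using ij block_mod_eq_iff[of i p j] by (auto simp: block_lower_bidiag_def block_mat_index)
qed

lemma block_upper_bidiag_upper: "block_upper (n * p) p (block_upper_bidiag n p d)"
  unfolding block_upper_def
proof (intro conjI allI impI)
  show "block_upper_bidiag n p d \<in> carrier_mat (n * p) (n * p)"
    by (simp add: block_upper_bidiag_def block_mat_carrier)
  fix i j assume ij: "i < n * p" "j < n * p" "j div p < i div p"
  then have "p > 0" by (cases p) auto
  then show "block_upper_bidiag n p d $$ (i, j) = 0"
    using ij by (auto simp: block_upper_bidiag_def block_mat_index)
qed

text \<open>Block row \<open>k\<close> of the upper factor meets only the inner indices
  \<open>k\<close> and \<open>k + 1\<close>. The latter is out of range for \<open>k = n\<close>,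
  which is why \<open>s n\<close> does not enter the last diagonal block.\<close>

lemma block_upper_lower_bidiag_mult_index:
  assumes d: "\<And>m. m \<in> {1..n} \<Longrightarrow> d m \<in> carrier_mat p p"
    and s: "\<And>m. m \<in> {1..n} \<Longrightarrow> s m \<in> carrier_mat p p"
    and ij: "i < n * p" "j < n * p"
    and k: "k = Suc (i div p)" and l: "l = Suc (j div p)"
  shows "(block_upper_bidiag n p d * block_lower_bidiag n p s) $$ (i, j) =
    (if l = k + 1 then 1\<^sub>m p else if k = l then (if k < n then d k + s k else d k)
     else if k = l + 1 then d k * s l else 0\<^sub>m p p) $$ (i mod p, j mod p)"
proof -
  let ?B = "\<lambda>k l. if k = l then d k else if l = k + 1 then 1\<^sub>m p else 0\<^sub>m p p"
  let ?C = "\<lambda>k l. if k = l then 1\<^sub>m p else if k = l + 1 then s l else 0\<^sub>m p p"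
  have p: "p > 0" using ij by (cases p) auto
  then have m: "i mod p < p" "j mod p < p" by auto
  have kl: "k \<in> {1..n}" "l \<in> {1..n}"
    using ij k l by (auto simp: less_mult_imp_div_less Suc_leI)
  have C: "?C a b \<in> carrier_mat p p" if "b \<in> {1..n}" for a b using s[OF that] by auto
  have "(block_upper_bidiag n p d * block_lower_bidiag n p s) $$ (i, j) =
    (\<Sum>m\<in>{1..n}. (?B k m * ?C m l) $$ (i mod p, j mod p))"
    unfolding block_upper_bidiag_def block_lower_bidiag_def k l
    using d s ij by (intro block_mat_mult_index) auto
  also have "\<dots> = (\<Sum>m\<in>{1..n}. (if m = k then (d k * ?C k l) $$ (i mod p, j mod p) else 0) +
    (if m = k + 1 then ?C (k + 1) l $$ (i mod p, j mod p) else 0))"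
  proof (rule sum.cong[OF refl])
    fix t assume "t \<in> {1..n}"
    note simps = left_mult_one_mat[OF s[OF kl(2)]] left_mult_one_mat[OF C[OF kl(2)]]
      left_mult_zero_mat[OF C[OF kl(2)]] m
    consider "t = k" | "t = k + 1" | "t \<noteq> k" "t \<noteq> k + 1" by blast
    then     show "(?B k t * ?C t l) $$ (i mod p, j mod p) =
      (if t = k then (d k * ?C k l) $$ (i mod p, j mod p) else 0) +
      (if t = k + 1 then ?C (k + 1) l $$ (i mod p, j mod p) else 0)"
      by cases (simp_all add: simps)
  qed
  also have "\<dots> = (d k * ?C k l) $$ (i mod p, j mod p) +
      (if k < n then ?C (k + 1) l $$ (i mod p, j mod p) else 0)"
    using kl by (simp add: sum.distrib sum.delta Suc_le_eq)
  also have "\<dots> = (if l = k + 1 then 1\<^sub>m p else if k = l then (if k < n then d k + s k else d k)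
     else if k = l + 1 then d k * s l else 0\<^sub>m p p) $$ (i mod p, j mod p)"
  proof -
    note simps = right_mult_one_mat[OF d[OF kl(1)]] right_mult_zero_mat[OF d[OF kl(1)]]
      right_mult_one_mat[OF d[OF kl(2)]] index_add_mat(1) m carrier_matD[OF s[OF kl(2)]]
    consider "l = k + 1" | "k = l" | "k = l + 1" | "l \<noteq> k + 1" "k \<noteq> l" "k \<noteq> l + 1" by blast
    then show ?thesis
    proof cases
      case 1
      then have "k < n" using kl by simp
      with 1 show ?thesis by (simp add: simps)
    qed (simp_all add: simps)
  qed
  finally show ?thesis .
qed

text \<open>In this order the inner indices are \<open>k - 1\<close> and \<open>k\<close>, so the
  exceptional block row is the first one.\<close>

lemma block_lower_upper_bidiag_mult_index:
  assumes d: "\<And>m. m \<in> {1..n} \<Longrightarrow> d m \<in> carrier_mat p p"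
    and s: "\<And>m. m \<in> {1..n} \<Longrightarrow> s m \<in> carrier_mat p p"
    and ij: "i < n * p" "j < n * p"
    and k: "k = Suc (i div p)" and l: "l = Suc (j div p)"
  shows "(block_lower_bidiag n p s * block_upper_bidiag n p d) $$ (i, j) =
    (if l = k + 1 then 1\<^sub>m p else if k = l then (if 1 < k then d k + s (k - 1) else d k)
     else if k = l + 1 then s l * d l else 0\<^sub>m p p) $$ (i mod p, j mod p)"
proof -
  let ?B = "\<lambda>k l. if k = l then d k else if l = k + 1 then 1\<^sub>m p else 0\<^sub>m p p"
  let ?C = "\<lambda>k l. if k = l then 1\<^sub>m p else if k = l + 1 then s l else 0\<^sub>m p p"
  have p: "p > 0" using ij by (cases p) auto
  then have m: "i mod p < p" "j mod p < p" by auto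
  have kl: "k \<in> {1..n}" "l \<in> {1..n}"
    using ij k l by (auto simp: less_mult_imp_div_less Suc_leI)
  have "(block_lower_bidiag n p s * block_upper_bidiag n p d) $$ (i, j) =
    (\<Sum>m\<in>{1..n}. (?C k m * ?B m l) $$ (i mod p, j mod p))"
    unfolding block_upper_bidiag_def block_lower_bidiag_def k l
    using d s ij by (intro block_mat_mult_index) auto
  also have "\<dots> = (\<Sum>m\<in>{1..n}. (if m = k then ?B k l $$ (i mod p, j mod p) else 0) +
    (if m = k - 1 then (s (k - 1) * ?B (k - 1) l) $$ (i mod p, j mod p) else 0))"
  proof (rule sum.cong[OF refl])
    fix t assume t: "t \<in> {1..n}"
    have *: "?B t l \<in> carrier_mat p p" using d[OF t] by auto
    note simps = left_mult_one_mat[OF *] left_mult_one_mat[OF d[OF kl(2)]] left_mult_zero_mat[OF *] m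
    consider "t = k" "t \<noteq> k - 1" | "k = t + 1" | "t \<noteq> k" "t \<noteq> k - 1" "k \<noteq> t + 1" using t kl by force
    then show "(?C k t * ?B t l) $$ (i mod p, j mod p) =
      (if t = k then ?B k l $$ (i mod p, j mod p) else 0) +
      (if t = k - 1 then (s (k - 1) * ?B (k - 1) l) $$ (i mod p, j mod p) else 0)"
      by cases (simp_all add: simps)
  qed
  also have "\<dots> = ?B k l $$ (i mod p, j mod p) +
      (if 1 < k then (s (k - 1) * ?B (k - 1) l) $$ (i mod p, j mod p) else 0)"
  proof -
    \<comment> \<open>For \<open>k = 1\<close> the predecessor is 0, outside the range of
      summation.\<close>
    have "k - 1 \<in> {1..n} \<longleftrightarrow> 1 < k" using kl by auto
    then show ?thesis using kl(1) by (simp only: sum.distrib sum.delta finite_atLeastAtMost if_True)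
  qed
  also have "\<dots> = (if l = k + 1 then 1\<^sub>m p else if k = l then (if 1 < k then d k + s (k - 1) else d k)
     else if k = l + 1 then s l * d l else 0\<^sub>m p p) $$ (i mod p, j mod p)"
  proof (cases "1 < k")
    case True
    then have s': "s (k - Suc 0) \<in> carrier_mat p p" using kl by (intro s) auto
    note simps = right_mult_one_mat[OF s'] right_mult_zero_mat[OF s']
      index_add_mat(1) m carrier_matD[OF s']
    consider "l = k + 1" | "k = l" | "k = l + 1" | "l \<noteq> k + 1" "k \<noteq> l" "k \<noteq> l + 1" by blast
    then show ?thesis
    proof cases
      case 2
      then have l: "s (l - Suc 0) \<in> carrier_mat p p" "l - Suc 0 \<noteq> l" using s' True by auto
      show ?thesis
        using True 2 m l(2) by (simp add: right_mult_one_mat[OF l(1)] carrier_matD[OF l(1)])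
    next
      case 4
      then have "k - 1 \<noteq> l" "l \<noteq> k - 1 + 1" using True by auto
      with 4 show ?thesis by (simp add: simps)
    qed (use True in \<open>simp_all add: simps\<close>)
  next
    case False
    then have "k \<noteq> l + 1" using kl by auto
    with False show ?thesis by simp
  qed
  finally show ?thesis .
qed

section \<open>The Lax relation and products of the lower factors\<close>

lemma L_mat_unit_lower: "block_unit_lower (n * p) p (L_mat n p e \<alpha>)"
  unfolding L_mat_def by (rule block_lower_bidiag_unit_lower)

lemma R_mat_upper: "block_upper (n * p) p (R_mat n p q \<alpha>)"
  unfolding R_mat_def by (rule block_upper_bidiag_upper)

lemmas L_mat_carrier = block_unit_lower_carrier[OF L_mat_unit_lower]
lemmas R_mat_carrier = block_upper_carrier[OF R_mat_upper]

text \<open>Compared block by block, the diagonal is the first recurrence, the subdiagonal the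
  second, and the superdiagonal consists of identities on both sides.\<close>

lemma L_mat_mult_R_mat:
  assumes "block_qd n p \<theta> q e"
  shows "L_mat n p e (\<alpha> + \<theta>) * R_mat n p q (\<alpha> + 1) = R_mat n p q \<alpha> * L_mat n p e \<alpha>"
proof (rule eq_matI)
  note qd = assms[unfolded block_qd_def]
  have q: "q m \<beta> \<in> carrier_mat p p" if "m \<in> {1..n}" for m \<beta> using qd that by blast
  have e: "e m \<beta> \<in> carrier_mat p p" if "m \<in> {1..n}" for m \<beta> using qd that by simp
  show "dim_row (L_mat n p e (\<alpha> + \<theta>) * R_mat n p q (\<alpha> + 1)) = dim_row (R_mat n p q \<alpha> * L_mat n p e \<alpha>)"
    "dim_col (L_mat n p e (\<alpha> + \<theta>) * R_mat n p q (\<alpha> + 1)) = dim_col (R_mat n p q \<alpha> * L_mat n p e \<alpha>)"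
    by (simp_all add: carrier_matD[OF L_mat_carrier] carrier_matD[OF R_mat_carrier])
  fix i j assume "i < dim_row (R_mat n p q \<alpha> * L_mat n p e \<alpha>)" "j < dim_col (R_mat n p q \<alpha> * L_mat n p e \<alpha>)"
  then have ij: "i < n * p" "j < n * p"
    by (simp_all add: carrier_matD[OF L_mat_carrier] carrier_matD[OF R_mat_carrier])
  define k l where "k = Suc (i div p)" and "l = Suc (j div p)"
  have kl: "k \<in> {1..n}" "l \<in> {1..n}"
    using ij by (auto simp: k_def l_def less_mult_imp_div_less Suc_leI)
  \<comment> \<open>The boundary values \<open>e 0 = 0\<close> and \<open>e n = 0\<close> make the
    recurrence agree with the truncated first and last diagonal blocks.\<close>
  have diag: "(if 1 < k then q k (\<alpha> + 1) + e (k - 1) (\<alpha> + \<theta>) else q k (\<alpha> + 1)) =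
    (if k < n then q k \<alpha> + e k \<alpha> else q k \<alpha>)"
  proof -
    have "q k (\<alpha> + 1) + e (k - 1) (\<alpha> + \<theta>) = q k \<alpha> + e k \<alpha>" using qd kl by blast
    moreover have "e (k - 1) (\<alpha> + \<theta>) = 0\<^sub>m p p" if "\<not> 1 < k"
    proof -
      have "k - 1 = 0" using that kl by auto
      then show ?thesis using qd by metis
    qed
    moreover have "e k \<alpha> = 0\<^sub>m p p" if "\<not> k < n"
    proof -
      have "k = n" using that kl by auto
      then show ?thesis using qd by metis
    qed
    ultimately show ?thesis
      using right_add_zero_mat[OF q[OF kl(1)]] by (auto split: if_splits)
  qed
  have sub: "e l (\<alpha> + \<theta>) * q l (\<alpha> + 1) = q k \<alpha> * e l \<alpha>" if "k = l + 1"
  proof -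
    have "l \<in> {1..<n}" using that kl by auto
    then show ?thesis using qd that by blast
  qed
  have "(L_mat n p e (\<alpha> + \<theta>) * R_mat n p q (\<alpha> + 1)) $$ (i, j) =
    (if l = k + 1 then 1\<^sub>m p
     else if k = l then (if 1 < k then q k (\<alpha> + 1) + e (k - 1) (\<alpha> + \<theta>) else q k (\<alpha> + 1))
     else if k = l + 1 then e l (\<alpha> + \<theta>) * q l (\<alpha> + 1) else 0\<^sub>m p p) $$ (i mod p, j mod p)"
    unfolding L_mat_def R_mat_def
    by (rule block_lower_upper_bidiag_mult_index[OF q e ij k_def l_def])
  also have "\<dots> = (if l = k + 1 then 1\<^sub>m p else if k = l then (if k < n then q k \<alpha> + e k \<alpha> else q k \<alpha>)
     else if k = l + 1 then q k \<alpha> * e l \<alpha> else 0\<^sub>m p p) $$ (i mod p, j mod p)"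
    unfolding diag using sub by presburger
  also have "\<dots> = (R_mat n p q \<alpha> * L_mat n p e \<alpha>) $$ (i, j)"
    unfolding L_mat_def R_mat_def
    by (rule block_upper_lower_bidiag_mult_index[OF q e ij k_def l_def, symmetric])
  finally show "(L_mat n p e (\<alpha> + \<theta>) * R_mat n p q (\<alpha> + 1)) $$ (i, j) = (R_mat n p q \<alpha> * L_mat n p e \<alpha>) $$ (i, j)" .
qed

text \<open>Starting at 0 this is P of the overview; with length \<theta> it is the lower factor of
  \<open>J_mat\<close>. Free start and length allow factors to be split off at either end.\<close>

definition L_prod :: "nat \<Rightarrow> nat \<Rightarrow> (nat \<Rightarrow> nat \<Rightarrow> real mat) \<Rightarrow> nat \<Rightarrow> nat \<Rightarrow> real mat" where
  "L_prod n p e \<alpha> r = foldr (*) (map (L_mat n p e) [\<alpha>..<\<alpha> + r]) (1\<^sub>m (n * p))"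

lemma foldr_mult_L_mat:
  assumes "M \<in> carrier_mat (n * p) (n * p)"
  shows "foldr (*) (map (L_mat n p e) xs) M = foldr (*) (map (L_mat n p e) xs) (1\<^sub>m (n * p)) * M"
    and "block_unit_lower (n * p) p (foldr (*) (map (L_mat n p e) xs) (1\<^sub>m (n * p)))"
proof -
  show unit: "block_unit_lower (n * p) p (foldr (*) (map (L_mat n p e) xs) (1\<^sub>m (n * p)))" for xs
    by (induction xs) (auto intro!: block_unit_lower_mult L_mat_unit_lower)
  show "foldr (*) (map (L_mat n p e) xs) M = foldr (*) (map (L_mat n p e) xs) (1\<^sub>m (n * p)) * M"
  proof (induction xs)
    case Nil
    then show ?case using assms by simp
  next
    case (Cons x xs)
    then show ?case
      using assoc_mult_mat[OF L_mat_carrier block_unit_lower_carrier[OF unit] assms] by simp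
  qed
qed

lemma L_prod_unit_lower: "block_unit_lower (n * p) p (L_prod n p e \<alpha> r)"
  unfolding L_prod_def by (rule foldr_mult_L_mat(2)[OF one_carrier_mat])

lemmas L_prod_carrier = block_unit_lower_carrier[OF L_prod_unit_lower]

lemma L_prod_0: "L_prod n p e \<alpha> 0 = 1\<^sub>m (n * p)"
  by (simp add: L_prod_def)

lemma L_prod_1: "L_prod n p e \<alpha> 1 = L_mat n p e \<alpha>"
  using right_mult_one_mat[OF L_mat_carrier] by (simp add: L_prod_def)

lemma L_prod_add: "L_prod n p e \<alpha> (r + s) = L_prod n p e \<alpha> r * L_prod n p e (\<alpha> + r) s"
proof -
  have "[\<alpha>..<\<alpha> + (r + s)] = [\<alpha>..<\<alpha> + r] @ [\<alpha> + r..<\<alpha> + r + s]"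
    using upt_add_eq_append[of \<alpha> "\<alpha> + r" s] by (simp add: add.assoc)
  then show ?thesis
    unfolding L_prod_def
    using foldr_mult_L_mat(1)[OF L_prod_carrier[unfolded L_prod_def]] by simp
qed

lemma J_mat_eq: "J_mat n p \<theta> q e \<alpha> = L_prod n p e \<alpha> \<theta> * R_mat n p q \<alpha>"
  unfolding J_mat_def L_prod_def by (rule foldr_mult_L_mat(1)[OF R_mat_carrier])

lemma J_mat_carrier: "J_mat n p \<theta> q e \<alpha> \<in> carrier_mat (n * p) (n * p)"
  unfolding J_mat_eq using L_prod_carrier R_mat_carrier by (rule mult_carrier_mat)

text \<open>The left-hand side is a run of \<theta> + 1 lower factors followed by
  \<open>R(\<alpha> + 1)\<close>. The Lax relation turns its last two factors into
  \<open>R(\<alpha>) L(\<alpha>)\<close>, and what precedes them completes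
  \<open>J(\<alpha>)\<close>.\<close>

lemma L_mat_mult_J_mat:
  assumes "block_qd n p \<theta> q e"
  shows "L_mat n p e \<alpha> * J_mat n p \<theta> q e (\<alpha> + 1) = J_mat n p \<theta> q e \<alpha> * L_mat n p e \<alpha>"
proof -
  note L = L_mat_carrier[of n p e] and R = R_mat_carrier[of n p q] and P = L_prod_carrier[of n p e]
  have "L_mat n p e \<alpha> * J_mat n p \<theta> q e (\<alpha> + 1) =
      L_prod n p e \<alpha> (1 + \<theta>) * R_mat n p q (\<alpha> + 1)"
    unfolding J_mat_eq L_prod_add L_prod_1
    by (rule assoc_mult_mat[OF L P R, symmetric])
  also have "L_prod n p e \<alpha> (1 + \<theta>) = L_prod n p e \<alpha> \<theta> * L_mat n p e (\<alpha> + \<theta>)"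
    using L_prod_add[of n p e \<alpha> \<theta> 1] by (simp only: L_prod_1 add.commute)
  also have "\<dots> * R_mat n p q (\<alpha> + 1) = L_prod n p e \<alpha> \<theta> * (R_mat n p q \<alpha> * L_mat n p e \<alpha>)"
    unfolding L_mat_mult_R_mat[OF assms, symmetric] by (rule assoc_mult_mat[OF P L R])
  also have "\<dots> = J_mat n p \<theta> q e \<alpha> * L_mat n p e \<alpha>"
    unfolding J_mat_eq by (rule assoc_mult_mat[OF P R L, symmetric])
  finally show ?thesis .
qed

lemma L_prod_mult_J_mat:
  assumes "block_qd n p \<theta> q e"
  shows "L_prod n p e 0 \<alpha> * J_mat n p \<theta> q e \<alpha> = J_mat n p \<theta> q e 0 * L_prod n p e 0 \<alpha>"
proof (induction \<alpha>)
  case 0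
  show ?case
    using left_mult_one_mat[OF J_mat_carrier] right_mult_one_mat[OF J_mat_carrier] by (simp add: L_prod_0)
next
  case (Suc \<alpha>)
  note L = L_mat_carrier[of n p e] and J = J_mat_carrier[of n p \<theta> q e] and P = L_prod_carrier[of n p e]
  have P': "L_prod n p e 0 (Suc \<alpha>) = L_prod n p e 0 \<alpha> * L_mat n p e \<alpha>"
    using L_prod_add[of n p e 0 \<alpha> 1] L_prod_1[of n p e] by simp
  have "L_prod n p e 0 (Suc \<alpha>) * J_mat n p \<theta> q e (Suc \<alpha>) =
      L_prod n p e 0 \<alpha> * (L_mat n p e \<alpha> * J_mat n p \<theta> q e (\<alpha> + 1))"
    unfolding P' using assoc_mult_mat[OF P L J] by simp
  also have "\<dots> = (L_prod n p e 0 \<alpha> * J_mat n p \<theta> q e \<alpha>) * L_mat n p e \<alpha>"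
    unfolding L_mat_mult_J_mat[OF assms] by (rule assoc_mult_mat[OF P J L, symmetric])
  also have "\<dots> = J_mat n p \<theta> q e 0 * L_prod n p e 0 (Suc \<alpha>)"
    unfolding Suc.IH P' by (rule assoc_mult_mat[OF J P L])
  finally show ?case .
qed

lemma pow_mat_Suc_left:
  assumes A: "A \<in> carrier_mat N N"
  shows "A ^\<^sub>m Suc k = A * A ^\<^sub>m k"
proof (induction k)
  case (Suc k)
  have "A ^\<^sub>m Suc (Suc k) = A * A ^\<^sub>m k * A" using Suc by simp
  also have "\<dots> = A * (A ^\<^sub>m k * A)"
    by (rule assoc_mult_mat[OF A pow_carrier_mat[OF A] A])
  finally show ?case by simp
qed (use A in simp)

text \<open>Multiplying by \<open>J(0)\<close> replaces \<open>P(\<theta>k)\<close> by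
  \<open>P(\<theta>k) J(\<theta>k) = P(\<theta>(k+1)) R(\<theta>k)\<close>, so each further power
  puts one more block upper factor \<open>R(\<theta>k)\<close> in front of \<open>U\<close>.\<close>

lemma J_mat_pow_decomp:
  assumes "block_qd n p \<theta> q e"
  shows "\<exists>U. block_upper (n * p) p U \<and>
    J_mat n p \<theta> q e 0 ^\<^sub>m k = L_prod n p e 0 (\<theta> * k) * U"
proof (induction k)
  case 0
  show ?case
    using carrier_matD[OF J_mat_carrier]
    by (intro exI[of _ "1\<^sub>m (n * p)"]) (auto simp: block_upper_def L_prod_0)
next
  case (Suc k)
  note R = R_mat_carrier[of n p q] and J = J_mat_carrier[of n p \<theta> q e] and P = L_prod_carrier[of n p e]
  from Suc obtain U where U: "block_upper (n * p) p U"
    and eq: "J_mat n p \<theta> q e 0 ^\<^sub>m k = L_prod n p e 0 (\<theta> * k) * U" by blast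
  note Uc = block_upper_carrier[OF U] and RU = mult_carrier_mat[OF R block_upper_carrier[OF U]]
  have "J_mat n p \<theta> q e 0 ^\<^sub>m Suc k = J_mat n p \<theta> q e 0 * J_mat n p \<theta> q e 0 ^\<^sub>m k"
    by (rule pow_mat_Suc_left[OF J])
  also have "\<dots> = J_mat n p \<theta> q e 0 * L_prod n p e 0 (\<theta> * k) * U"
    unfolding eq by (rule assoc_mult_mat[OF J P Uc, symmetric])
  also have "\<dots> = L_prod n p e 0 (\<theta> * k) * (L_prod n p e (\<theta> * k) \<theta> * (R_mat n p q (\<theta> * k) * U))"
    unfolding L_prod_mult_J_mat[OF assms, symmetric]
    unfolding J_mat_eq assoc_mult_mat[OF P mult_carrier_mat[OF P R] Uc] assoc_mult_mat[OF P R Uc] ..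
  also have "\<dots> = L_prod n p e 0 (\<theta> * Suc k) * (R_mat n p q (\<theta> * k) * U)"
    using L_prod_add[of n p e 0 "\<theta> * k" \<theta>] assoc_mult_mat[OF P P RU] by (simp add: add.commute)
  finally show ?case using block_upper_mult[OF R_mat_upper U] by blast
qed

section \<open>Convergence\<close>

lemma block_unit_lower_map_of_real:
  "block_unit_lower N p A \<Longrightarrow>
    block_unit_lower N p (map_mat (of_real :: real \<Rightarrow> 'a::real_normed_field) A)"
  unfolding block_unit_lower_def by auto

lemma block_upper_map_of_real:
  "block_upper N p A \<Longrightarrow>
    block_upper N p (map_mat (of_real :: real \<Rightarrow> 'a::real_normed_field) A)"
  unfolding block_upper_def by auto

section \<open>Powers of diagonalized matrices and eigenvalue ratios\<close>

lemma block_upper_mat_diag: "block_upper N p (mat_diag N f)"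
  unfolding block_upper_def by (auto simp: mat_diag_def)

lemma diagonalized_pow_mat:
  assumes X: "X \<in> carrier_mat N N" and Y: "Y \<in> carrier_mat N N" and inv: "X * Y = 1\<^sub>m N" "Y * X = 1\<^sub>m N"
    and A: "A = X * mat_diag N f * (Y :: 'a::comm_ring_1 mat)"
  shows "A ^\<^sub>m k = X * mat_diag N (\<lambda>i. f i ^ k) * Y"
proof (induction k)
  case 0
  show ?case using X Y inv by (simp add: A)
next
  case (Suc k)
  note assoc = assoc_mult_mat[of _ N N _ N _ N] and carrier = mult_carrier_mat[of _ N N _ N]
  have "A ^\<^sub>m Suc k = X * mat_diag N (\<lambda>i. f i ^ k) * (Y * X) * mat_diag N f * Y"
    using X Y by (simp only: pow_mat.simps Suc.IH) (simp add: A assoc carrier)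
  also have "\<dots> = X * mat_diag N (\<lambda>i. f i ^ k) * mat_diag N f * Y"
    unfolding inv right_mult_one_mat[OF mult_carrier_mat[OF X mat_diag_dim]] ..
  also have "\<dots> = X * (mat_diag N (\<lambda>i. f i ^ k) * mat_diag N f) * Y"
    unfolding assoc_mult_mat[OF X mat_diag_dim mat_diag_dim] ..
  finally show ?case by (simp add: mult.commute)
qed

text \<open>Conjugation multiplies entry \<open>(i, j)\<close> by the power of the ratio of
  \<open>\<mu> i\<close> to \<open>\<mu> j\<close>, which decays below the block diagonal. A zero
  eigenvalue, having inverse 0 by convention, leaves 0 instead of 1 on the diagonal of the
  limit.\<close>

lemma diag_conj_block_unit_lower_LIMSEQ:
  fixes \<mu> :: "nat \<Rightarrow> 'a::real_normed_field"
  assumes L: "block_unit_lower N p L"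
    and \<mu>: "\<And>i j. i < j \<Longrightarrow> j < N \<Longrightarrow> norm (\<mu> j) < norm (\<mu> i)"
  shows "mat_LIMSEQ (\<lambda>k. mat_diag N (\<lambda>i. \<mu> i ^ k) * L * mat_diag N (\<lambda>i. inverse (\<mu> i) ^ k))
    (mat_diag N (\<lambda>i. if \<mu> i = 0 then 0 else 1))"
  unfolding mat_LIMSEQ_iff[OF mat_diag_dim]
proof (intro conjI allI impI)
  have Lc: "L \<in> carrier_mat N N" by (rule block_unit_lower_carrier[OF L])
  show "mat_diag N (\<lambda>i. \<mu> i ^ k) * L * mat_diag N (\<lambda>i. inverse (\<mu> i) ^ k) \<in> carrier_mat N N" for k
    by (intro mult_carrier_mat[of _ N N _ N] Lc mat_diag_dim)
  fix i j assume ij: "i < N" "j < N"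
  have entry: "(mat_diag N (\<lambda>i. \<mu> i ^ k) * L * mat_diag N (\<lambda>i. inverse (\<mu> i) ^ k)) $$ (i, j) =
      L $$ (i, j) * (\<mu> i * inverse (\<mu> j)) ^ k" for k
    using ij unfolding mat_diag_mult_left[OF Lc]
    by (subst mat_diag_mult_right[of _ N]) (auto simp: power_mult_distrib)
  have "(\<lambda>k. L $$ (i, j) * (\<mu> i * inverse (\<mu> j)) ^ k) \<longlonglongrightarrow> (if i = j \<and> \<mu> i \<noteq> 0 then 1 else 0)"
  proof (cases "i div p \<le> j div p")
    case True
    show ?thesis
    proof (cases "i = j \<and> \<mu> i \<noteq> 0")
      case False
      then have "L $$ (i, j) = 0 \<or> \<mu> i * inverse (\<mu> j) = 0"
        using block_unit_lower_index[OF L ij True] by auto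
      then show ?thesis
      proof
        assume "\<mu> i * inverse (\<mu> j) = 0"
        then show ?thesis
          using False by (auto intro!: tendsto_mult_right_zero LIMSEQ_power_zero simp del: mult_eq_0_iff)
      qed (use False in auto)
    qed (use block_unit_lower_index[OF L ij True] in auto)
  next
    case False
    then have "j < i" using div_le_mono[of i j p] by linarith
    then have less: "norm (\<mu> i) < norm (\<mu> j)" using \<mu> ij by simp
    moreover have "0 < norm (\<mu> j)" using less norm_ge_zero le_less_trans by blast
    ultimately have "norm (\<mu> i * inverse (\<mu> j)) < 1"
      by (simp add: divide_inverse[symmetric] norm_divide)
    then show ?thesis
      using \<open>j < i\<close> by (auto intro!: tendsto_mult_right_zero LIMSEQ_power_zero)
  qed
  then show "(\<lambda>k. (mat_diag N (\<lambda>i. \<mu> i ^ k) * L * mat_diag N (\<lambda>i. inverse (\<mu> i) ^ k)) $$ (i, j))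
      \<longlonglongrightarrow> mat_diag N (\<lambda>i. if \<mu> i = 0 then 0 else 1) $$ (i, j)"
    using ij unfolding entry by (auto simp: mat_diag_def)
qed

text \<open>\<open>M\<close> is the inverse of the lower factor of \<open>X\<close>. Multiplying \<open>M * P k\<close> by a suitable block upper
  triangular matrix \<open>V k\<close> cancels the growth of the eigenvalue powers. The inverse of a zero
  eigenvalue is 0 here, so the product tends to the identity except in the last block column.\<close>

lemma block_LR_factor_LIMSEQ:
  fixes A X Y :: "'a::real_normed_field mat"
  assumes X: "X \<in> carrier_mat (n * p) (n * p)" and Y: "Y \<in> carrier_mat (n * p) (n * p)"
    and inv: "X * Y = 1\<^sub>m (n * p)" "Y * X = 1\<^sub>m (n * p)"
    and A: "A = X * mat_diag (n * p) \<mu> * Y"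
    and \<mu>: "\<And>i j. i < j \<Longrightarrow> j < n * p \<Longrightarrow> norm (\<mu> j) < norm (\<mu> i)"
    and minors: "\<And>k. k \<in> {1..<n} \<Longrightarrow> leading_block_minor p k X \<noteq> 0"
      "\<And>k. k \<in> {1..<n} \<Longrightarrow> leading_block_minor p k Y \<noteq> 0"
    and P: "\<And>k. block_unit_lower (n * p) p (P k)" and U: "\<And>k. block_upper (n * p) p (U k)"
    and PU: "\<And>k. A ^\<^sub>m k = P k * U k"
  shows "\<exists>M. block_unit_lower (n * p) p M \<and> mat_LIMSEQ (\<lambda>k. M * P k) (1\<^sub>m (n * p))"
proof -
  let ?N = "n * p"
  note assoc = assoc_mult_mat[of _ ?N ?N _ ?N _ ?N] and carrier = mult_carrier_mat[of _ ?N ?N _ ?N]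
  have "det X * det Y = 1" using det_mult[OF X Y] by (simp add: inv)
  then have det: "det X \<noteq> 0" "det Y \<noteq> 0" by auto
  \<comment> \<open>\<open>X * W\<close> and \<open>Y * W'\<close> are the lower factors of
    \<open>X\<close> and of its inverse.\<close>
  obtain W W' where W: "block_upper ?N p W" "block_unit_lower ?N p (X * W)"
    and W': "block_upper ?N p W'" "block_unit_lower ?N p (Y * W')"
    using block_lower_factor_exists[OF X det(1) minors(1)]
      block_lower_factor_exists[OF Y det(2) minors(2)] by blast
  obtain M where M: "block_unit_lower ?N p M" "M * (X * W) = 1\<^sub>m ?N"
    using block_unit_lower_inverse[OF W(2)] by blast
  note Wc = block_upper_carrier[OF W(1)] and W'c = block_upper_carrier[OF W'(1)]
    and Mc = block_unit_lower_carrier[OF M(1)]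
    and Pc = block_unit_lower_carrier[OF P] and Uc = block_upper_carrier[OF U]
  define D where "D k = mat_diag ?N (\<lambda>i. \<mu> i ^ k)" for k :: nat
  define D' where "D' k = mat_diag ?N (\<lambda>i. inverse (\<mu> i) ^ k)" for k :: nat
  define E where "E = mat_diag ?N (\<lambda>i. if \<mu> i = 0 then 0 else 1 :: 'a)"
  \<comment> \<open>Substituting \<open>P k * U k = X * D k * Y\<close>, the factor
    \<open>W'\<close> makes \<open>Y\<close> lower triangular, \<open>D' k\<close> completes the
    conjugation by \<open>D k\<close>, and \<open>W\<close> turns \<open>M * X\<close> into the
    identity in the limit, up to \<open>E\<close>.\<close>
  define V where "V k = U k * (W' * (D' k * W))" for k
  have Dc: "D k \<in> carrier_mat ?N ?N" "D' k \<in> carrier_mat ?N ?N" "E \<in> carrier_mat ?N ?N" for k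
    by (simp_all add: D_def D'_def E_def)
  note cs = X Y Wc W'c Mc Pc Uc Dc
  have V: "block_upper ?N p (V k)" for k
    unfolding V_def D'_def by (intro block_upper_mult U W W' block_upper_mat_diag)
  have GV: "(M * P k) * V k = (M * X) * ((D k * (Y * W') * D' k) * W)" for k
  proof -
    have "(M * P k) * V k = M * ((P k * U k) * (W' * (D' k * W)))"
      using cs by (simp add: V_def assoc carrier)
    also have "P k * U k = X * D k * Y"
      unfolding PU[symmetric] D_def by (rule diagonalized_pow_mat[OF X Y inv A])
    finally show ?thesis using cs by (simp add: assoc carrier)
  qed
  have "mat_LIMSEQ (\<lambda>k. D k * (Y * W') * D' k) E"
    unfolding D_def D'_def E_def by (rule diag_conj_block_unit_lower_LIMSEQ[OF W'(2) \<mu>])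
  then have lim: "mat_LIMSEQ (\<lambda>k. (M * P k) * V k) ((M * X) * (E * W))"
    unfolding GV
    by (intro mat_LIMSEQ_mult[where N = ?N and nr = ?N and nc = ?N] mat_LIMSEQ_const carrier cs)
  \<comment> \<open>Every eigenvalue but the last exceeds another in modulus, hence is
    nonzero.\<close>
  have \<mu>0: "\<mu> b \<noteq> 0" if "Suc b < ?N" for b
    using \<mu>[of b "Suc b"] that by auto
  have "mat_LIMSEQ (\<lambda>k. M * P k) (1\<^sub>m ?N)"
  proof (rule block_lower_upper_LIMSEQ[OF block_unit_lower_mult[OF M(1) P] V])
    fix a c assume ac: "a < ?N" "c < ?N" and c: "Suc (c div p) < n"
    then have p: "p > 0" by (cases p) auto
    \<comment> \<open>\<open>E\<close> can differ from the identity only in the very last row, where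
      the block upper \<open>W\<close> has zeros in every column before the last block.\<close>
    have EW: "(E * W) $$ (b, c) = W $$ (b, c)" if b: "b < ?N" for b
    proof (cases "\<mu> b = 0")
      case True
      then have "?N \<le> Suc b" using \<mu>0 not_less by blast
      moreover have "Suc (c div p) * p < n * p" using c p by (simp only: mult_less_cancel2)
      ultimately have "Suc (c div p) * p \<le> b" by linarith
      then have "c div p < b div p" using p by (simp add: less_eq_div_iff_mult_less_eq[symmetric] Suc_le_eq del: mult_Suc)
      then show ?thesis
        using block_upper_index[OF W(1) b ac(2)] b ac True by (simp add: E_def mat_diag_mult_left[OF Wc])
    next
      case False
      then show ?thesis using b ac by (simp add: E_def mat_diag_mult_left[OF Wc])
    qed
    have MX: "M * X \<in> carrier_mat ?N ?N" and EWc: "E * W \<in> carrier_mat ?N ?N" using cs by (auto intro: carrier)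
    have "((M * X) * (E * W)) $$ (a, c) = ((M * X) * W) $$ (a, c)"
      unfolding mult_mat_index_sum[OF MX EWc ac] mult_mat_index_sum[OF MX Wc ac]
      by (intro sum.cong) (auto simp: EW simp del: index_mult_mat)
    also have "\<dots> = (if a = c then 1 else 0)"
      using ac M(2) assoc_mult_mat[OF Mc X Wc] by simp
    moreover have "(\<lambda>k. (M * P k * V k) $$ (a, c)) \<longlonglongrightarrow> ((M * X) * (E * W)) $$ (a, c)"
      using lim ac by (simp add: mat_LIMSEQ_iff[OF mult_carrier_mat[OF MX EWc]] del: index_mult_mat)
    ultimately show "(\<lambda>k. (M * P k * V k) $$ (a, c)) \<longlonglongrightarrow> (if a = c then 1 else 0)"
      by simp
  qed
  then show ?thesis using M(1) by blast
qed

text \<open>The eigenvector matrices are complex and the algorithm is real; this brings the limits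
  back.\<close>

lemma mat_LIMSEQ_Re:
  assumes "mat_LIMSEQ (\<lambda>k. map_mat complex_of_real (A k)) Z" "Z \<in> carrier_mat nr nc"
    and "i < nr" "j < nc"
  shows "(\<lambda>k. A k $$ (i, j)) \<longlonglongrightarrow> Re (Z $$ (i, j))"
proof -
  have A: "A k \<in> carrier_mat nr nc" for k
    using assms(1) by (simp add: mat_LIMSEQ_iff[OF assms(2)])
  have "(\<lambda>k. Re (map_mat complex_of_real (A k) $$ (i, j))) \<longlonglongrightarrow> Re (Z $$ (i, j))"
    using assms by (intro tendsto_Re) (simp add: mat_LIMSEQ_iff[OF assms(2)])
  then show ?thesis using carrier_matD[OF A] assms(3,4) by simp
qed

theorem theorem4p2:
  fixes n p \<theta> :: nat
    and q e :: "nat \<Rightarrow> nat \<Rightarrow> real mat"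
    and lam :: "nat \<Rightarrow> complex"
    and X X_inv :: "complex mat"
  assumes "n \<ge> 1" and "p \<ge> 1" and "\<theta> \<ge> 1"
    and "block_qd n p \<theta> q e"
    and "\<And>i. i \<in> {1..n * p} \<Longrightarrow> eigenvalue (map_mat complex_of_real (J_mat n p \<theta> q e 0)) (lam i)"
    and "\<And>i. i \<in> {1..<n * p} \<Longrightarrow> cmod (lam i) > cmod (lam (i + 1))"
    and "X \<in> carrier_mat (n * p) (n * p)" and "X_inv \<in> carrier_mat (n * p) (n * p)"
    and "inverts_mat X X_inv" and "inverts_mat X_inv X"
    and "map_mat complex_of_real (J_mat n p \<theta> q e 0)
           = X * mat_diag (n * p) (\<lambda>i. lam (i + 1)) * X_inv"
    and "\<And>k. k \<in> {1..<n} \<Longrightarrow> leading_block_minor p k X \<noteq> 0"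
    and "\<And>k. k \<in> {1..<n} \<Longrightarrow> leading_block_minor p k X_inv \<noteq> 0"
  shows "\<exists>q_lim :: nat \<Rightarrow> real mat.
           (\<forall>m\<in>{1..n}. mat_LIMSEQ (\<lambda>\<alpha>. q m (\<theta> * \<alpha>)) (q_lim m)) \<and>
           mat_LIMSEQ (\<lambda>\<alpha>. J_mat n p \<theta> q e (\<theta> * \<alpha>)) (block_upper_bidiag n p q_lim)"
proof -
  let ?N = "n * p"
  let ?c = "map_mat complex_of_real"
  note assoc = assoc_mult_mat[of _ ?N ?N _ ?N _ ?N] and carrier = mult_carrier_mat[of _ ?N ?N _ ?N]
  note qd = \<open>block_qd n p \<theta> q e\<close>
  have \<mu>: "cmod (lam (j + 1)) < cmod (lam (i + 1))" if "i < j" "j < ?N" for i j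
    using that
  proof (induction j rule: less_Suc_induct)
    fix i assume "Suc i < ?N"
    then show "cmod (lam (Suc i + 1)) < cmod (lam (i + 1))" using assms(6)[of "i + 1"] by simp
  qed auto
  define P where "P k = L_prod n p e 0 (\<theta> * k)" for k
  define J where "J k = J_mat n p \<theta> q e (\<theta> * k)" for k
  define R where "R k = R_mat n p q (\<theta> * k)" for k
  have Pc: "P k \<in> carrier_mat ?N ?N" and Jc: "J k \<in> carrier_mat ?N ?N" and Rc: "R k \<in> carrier_mat ?N ?N" for k
    by (simp_all add: P_def J_def R_def L_prod_carrier J_mat_carrier R_mat_carrier)
  have PJ: "P k * J k = J 0 * P k" for k
    using L_prod_mult_J_mat[OF qd, of "\<theta> * k"] by (simp add: P_def J_def)
  \<comment> \<open>\<open>R\<close> at step \<open>k\<close> links two consecutive products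
    \<open>P\<close>, as \<open>J k\<close> is \<open>L_prod\<close> of length \<theta> times
    \<open>R k\<close> and the lower part extends \<open>P k\<close> to
    \<open>P (Suc k)\<close>.\<close>
  have PR: "P (Suc k) * R k = J 0 * P k" for k
    using L_prod_add[of n p e 0 "\<theta> * k" \<theta>] assoc_mult_mat[OF L_prod_carrier L_prod_carrier R_mat_carrier]
    unfolding PJ[symmetric] by (simp add: P_def J_def R_def J_mat_eq add.commute)
  obtain U where U: "\<And>k. block_upper ?N p (U k)" and JPU: "\<And>k. J 0 ^\<^sub>m k = P k * U k"
    using J_mat_pow_decomp[OF qd] unfolding J_def P_def mult_0_right by metis
  note hom = of_real_hom.mat_hom_mult[where 'a = complex]
  have cPU: "?c (J 0) ^\<^sub>m k = ?c (P k) * ?c (U k)" for k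
    unfolding of_real_hom.mat_hom_pow[OF Jc, symmetric] JPU by (rule hom[OF Pc block_upper_carrier[OF U]])
  obtain M where M: "block_unit_lower ?N p M" and G: "mat_LIMSEQ (\<lambda>k. M * ?c (P k)) (1\<^sub>m ?N)"
  proof -
    have "\<exists>M. block_unit_lower ?N p M \<and> mat_LIMSEQ (\<lambda>k. M * ?c (P k)) (1\<^sub>m ?N)"
    proof (rule block_LR_factor_LIMSEQ[where U = "\<lambda>k. ?c (U k)"])
      show "?c (J 0) = X * mat_diag ?N (\<lambda>i. lam (i + 1)) * X_inv"
        using assms(11) by (simp add: J_def)
      show "X * X_inv = 1\<^sub>m ?N" "X_inv * X = 1\<^sub>m ?N"
        using assms(7-10) by (auto simp: inverts_mat_def)
      show "block_unit_lower ?N p (?c (P k))" "block_upper ?N p (?c (U k))" for k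
        by (simp_all add: P_def block_unit_lower_map_of_real block_upper_map_of_real L_prod_unit_lower U)
    qed (use assms \<mu> cPU in simp_all)
    then show ?thesis using that by blast
  qed
  define G where "G k = M * ?c (P k)" for k
  have G_unit: "block_unit_lower ?N p (G k)" for k
    unfolding G_def P_def
    by (intro block_unit_lower_mult M block_unit_lower_map_of_real L_prod_unit_lower)
  note Gc = block_unit_lower_carrier[OF G_unit] and Mc = block_unit_lower_carrier[OF M]
  obtain L where L: "block_unit_lower ?N p L" "L * M = 1\<^sub>m ?N"
    using block_unit_lower_inverse[OF M] by blast
  note Lc = block_unit_lower_carrier[OF L(1)]
  \<comment> \<open>\<open>L\<close> is the lower factor of \<open>X\<close> and \<open>M\<close>
    its inverse, so this is the expected limit of \<open>J k\<close>.\<close>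
  define Z where "Z = M * ?c (J 0) * L"
  have Zc: "Z \<in> carrier_mat ?N ?N" using Mc Lc Jc by (auto simp: Z_def intro!: carrier)
  have P_eq: "?c (P k) = L * G k" for k
    using assoc_mult_mat[OF Lc Mc, of "?c (P k)" ?N] Pc[of k] by (simp add: G_def L(2))
  have ZG: "M * (?c (J 0 * P k)) = Z * G k" for k
    using hom[OF Jc Pc] Mc Lc Gc Jc by (simp add: P_eq Z_def assoc carrier)
  have ZG_lim: "mat_LIMSEQ (\<lambda>k. Z * G k) Z"
    using mat_LIMSEQ_mult[OF mat_LIMSEQ_const G Zc one_carrier_mat] right_mult_one_mat[OF Zc]
    by (simp add: G_def)
  have G_Suc: "mat_LIMSEQ (\<lambda>k. G (Suc k)) (1\<^sub>m ?N)"
    using G Gc unfolding G_def[symmetric] mat_LIMSEQ_iff[OF one_carrier_mat]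
    by (auto intro: LIMSEQ_Suc simp del: index_one_mat)
  \<comment> \<open>This is \<open>P k * J k = J 0 * P k\<close> multiplied by \<open>M\<close>. As
    \<open>G k\<close> tends to the identity, cancelling it on the left gives the limit of
    \<open>J k\<close>.\<close>
  have "G k * ?c (J k) = Z * G k" for k
    using assoc_mult_mat[OF Mc, of "?c (P k)" ?N "?c (J k)" ?N] Pc[of k] Jc[of k]
    unfolding ZG[symmetric] PJ[symmetric] hom[OF Pc Jc] by (simp add: G_def)
  then have J_lim: "mat_LIMSEQ (\<lambda>k. ?c (J k)) Z"
    using block_unit_lower_LIMSEQ_cancel[OF G_unit G[folded G_def] _ Zc, of "\<lambda>k. ?c (J k)"] Jc ZG_lim by simp
  \<comment> \<open>The same cancellation with the shifted \<open>G\<close> shows that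
    \<open>R k\<close> has the same limit \<open>Z\<close> as \<open>J k\<close>.\<close>
  have "G (Suc k) * ?c (R k) = Z * G k" for k
    using assoc_mult_mat[OF Mc, of "?c (P (Suc k))" ?N "?c (R k)" ?N] Pc[of "Suc k"] Rc[of k]
    unfolding ZG[symmetric] PR[symmetric] hom[OF Pc Rc] by (simp add: G_def)
  then have R_lim: "mat_LIMSEQ (\<lambda>k. ?c (R k)) Z"
    using block_unit_lower_LIMSEQ_cancel[OF G_unit G_Suc _ Zc, of "\<lambda>k. ?c (R k)"] Rc ZG_lim by simp
  \<comment> \<open>The diagonal blocks of \<open>Z\<close>; \<open>m - 1\<close> converts the block
    number to an offset from 0.\<close>
  define q_lim where "q_lim m = mat p p (\<lambda>(r, s). Re (Z $$ ((m - 1) * p + r, (m - 1) * p + s)))" for m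
  have qlc: "q_lim m \<in> carrier_mat p p" for m by (simp add: q_lim_def)
  have qc: "q m \<alpha> \<in> carrier_mat p p" if "m \<in> {1..n}" for m \<alpha>
    using qd that unfolding block_qd_def by blast
  have q_lim: "mat_LIMSEQ (\<lambda>\<alpha>. q m (\<theta> * \<alpha>)) (q_lim m)" if m: "m \<in> {1..n}" for m
  proof -
    have "(\<lambda>\<alpha>. q m (\<theta> * \<alpha>) $$ (r, s)) \<longlonglongrightarrow> q_lim m $$ (r, s)" if rs: "r < p" "s < p" for r s
    proof -
      have "(m - 1) * p + t < ?N" if "t < p" for t
      proof -
        have "(m - 1) * p + t < Suc (m - 1) * p" using that by simp
        also have "\<dots> \<le> n * p" using m by (intro mult_le_mono1) auto
        finally show ?thesis .
      qed
      note ij = this[OF rs(1)] this[OF rs(2)]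
      have "R \<alpha> $$ ((m - 1) * p + r, (m - 1) * p + s) = q m (\<theta> * \<alpha>) $$ (r, s)" for \<alpha>
        unfolding R_def R_mat_def block_upper_bidiag_def block_mat_index[OF ij]
        using m rs by simp
      then show ?thesis
        using mat_LIMSEQ_Re[OF R_lim Zc ij] rs by (simp add: q_lim_def)
    qed
    then show ?thesis using qc[OF m] by (simp add: mat_LIMSEQ_iff[OF qlc])
  qed
  \<comment> \<open>Off the diagonal the blocks of \<open>R k\<close> are constant identities or
    zeros, so uniqueness of limits determines every entry of the real part of
    \<open>Z\<close>.\<close>
  have bidiag: "Re (Z $$ (i, j)) = block_upper_bidiag n p q_lim $$ (i, j)" if ij: "i < ?N" "j < ?N" for i j
  proof -
    have p: "p > 0" using \<open>p \<ge> 1\<close> by simp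
    have i: "Suc (i div p) \<in> {1..n}" using ij by (simp add: less_mult_imp_div_less Suc_leI)
    have "(\<lambda>\<alpha>. q (Suc (i div p)) (\<theta> * \<alpha>) $$ (i mod p, j mod p)) \<longlonglongrightarrow> q_lim (Suc (i div p)) $$ (i mod p, j mod p)"
      using q_lim[OF i] p by (simp add: mat_LIMSEQ_iff[OF qlc])
    then have "(\<lambda>\<alpha>. R \<alpha> $$ (i, j)) \<longlonglongrightarrow> block_upper_bidiag n p q_lim $$ (i, j)"
      unfolding R_def R_mat_def block_upper_bidiag_def block_mat_index[OF ij]
      by (cases "i div p = j div p") simp_all
    then show ?thesis using mat_LIMSEQ_Re[OF R_lim Zc ij] LIMSEQ_unique by blast
  qed
  have "mat_LIMSEQ J (block_upper_bidiag n p q_lim)"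
    using Jc mat_LIMSEQ_Re[OF J_lim Zc]
    by (simp add: mat_LIMSEQ_iff[OF block_upper_carrier[OF block_upper_bidiag_upper]] bidiag[symmetric])
  then show ?thesis using q_lim unfolding J_def by blast
qed

end
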